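(* Let $d\ge2$. (1) The spaces $(\mathcal{K}_0^d,d_{AW^r})$ and $(\mathcal{F}^d,d_{AW^r})$ are homeomorphic. (2) The flower map $\clubsuit:(\mathcal{K}_0^d,d_{AW})\to(\mathcal{F}^d,d_{AW^r})$, $K\mapsto K^\clubsuit$, is not continuous.
   Context: $\mathbb{N}=\{1,2,\dots\}$; $B_2^d$ and $\mathbb{S}^{d-1}$ are the closed Euclidean unit ball and the unit sphere of $\mathbb{R}^d$. $\mathcal{K}_0^d$ is the family of closed convex sets $K\subseteq\mathbb{R}^d$ containing the origin. A star set is a non-empty $A\subseteq\mathbb{R}^d$ with $ta\in A$ for all $a\in A$, $0\le t\le 1$. Its radial function is $\rho_A:\mathbb{S}^{d-1}\to[0,\infty]$, $\rho_A(\theta)=\sup\{\lambda\ge 0:\lambda\theta\in A\}$. A star body is a star set $A$ that is radially closed: $\rho_A(\theta)\theta\in A$ whenever $\rho_A(\theta)<\infty$; members of $\mathcal{K}_0^d$ are star bodies. For a star set $S$, $rc(S)$ denotes its radial closure, i.e. the unique star body with radial function $\rho_S$. For $x\in\mathbb{R}^d$ let $B_x=\{y\in\mathbb{R}^d:\|y-\frac{x}{2}\|\le\frac{\|x\|}{2}\}$. A flower is a star body of the form $F=rc(\bigcup_{x\in C}B_x)$ for some non-empty closed $C\subseteq\mathbb{R}^d$; $\mathcal{F}^d$ is the family of flowers in $\mathbb{R}^d$. For $K\in\mathcal{K}_0^d$, the flower of $K$, $K^\clubsuit$, is the star body with radial function $\rho_{K^\clubsuit}=h_K|_{\mathbb{S}^{d-1}}$,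 where $h_K(\theta)=\sup_{y\in K}\langle y,\theta\rangle\in[0,\infty]$ is the support function; it is known that $K\mapsto K^\clubsuit$ is a bijection $\mathcal{K}_0^d\to\mathcal{F}^d$. The radial sum $A_1\tilde{+}A_2$ of star bodies is the star body with radial function $\rho_{A_1}+\rho_{A_2}$. The radial distance from $x\in\mathbb{R}^d$ to a star body $A$ is $d_r(x,A)=\inf\{\alpha>0: x\in A\tilde{+}\alpha B_2^d\}$, and the radial Attouch-Wets distance is $d_{AW^r}(A_1,A_2)=\sup_{j\in\mathbb{N}}\min\{\frac1j,\sup_{\|x\|\le j}|d_r(x,A_1)-d_r(x,A_2)|\}$. With $d(x,C)=\inf_{c\in C}\|x-c\|$, the Attouch-Wets distance of non-empty closed sets is $d_{AW}(C_1,C_2)=\sup_{j\in\mathbb{N}}\min\{\frac1j,\sup_{\|x\|<j}|d(x,C_1)-d(x,C_2)|\}$. *)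

theory Defs
  imports "HOL-Analysis.Analysis"
begin

definition K0 :: "'a::euclidean_space set set" where
  "K0 = {K. closed K \<and> convex K \<and> 0 \<in> K}"

definition star_set :: "'a::euclidean_space set \<Rightarrow> bool" where
  "star_set A \<longleftrightarrow> A \<noteq> {} \<and> (\<forall>a\<in>A. \<forall>t. 0 \<le> t \<and> t \<le> 1 \<longrightarrow> t *\<^sub>R a \<in> A)"

text \<open>Radial functions are only meaningful on the unit sphere; their values off the sphere are
  never used below.\<close>

definition radial_function :: "'a::euclidean_space set \<Rightarrow> 'a \<Rightarrow> ennreal" where
  "radial_function A \<theta> = (SUP l\<in>{l. 0 \<le> l \<and> l *\<^sub>R \<theta> \<in> A}. ennreal l)"

definition star_body :: "'a::euclidean_space set \<Rightarrow> bool" where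
  "star_body A \<longleftrightarrow> star_set A \<and>
     (\<forall>\<theta>\<in>sphere 0 1. radial_function A \<theta> < top \<longrightarrow> enn2real (radial_function A \<theta>) *\<^sub>R \<theta> \<in> A)"

text \<open>Every function from the sphere to \<open>[0,\<infinity>]\<close> is the radial function of exactly one star body
  (lemmas \<open>star_body_star_body_of\<close>, \<open>radial_function_star_body_of\<close>, \<open>star_body_eqI\<close>).\<close>

definition star_body_of :: "('a::euclidean_space \<Rightarrow> ennreal) \<Rightarrow> 'a set" where
  "star_body_of f = (THE A. star_body A \<and> (\<forall>\<theta>\<in>sphere 0 1. radial_function A \<theta> = f \<theta>))"

definition radial_closure :: "'a::euclidean_space set \<Rightarrow> 'a set" where
  "radial_closure S = star_body_of (radial_function S)"

definition radial_sum :: "'a::euclidean_space set \<Rightarrow> 'a set \<Rightarrow> 'a set" where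
  "radial_sum A B = star_body_of (\<lambda>\<theta>. radial_function A \<theta> + radial_function B \<theta>)"

definition diameter_ball :: "'a::euclidean_space \<Rightarrow> 'a set" where
  "diameter_ball x = cball (x /\<^sub>R 2) (norm x / 2)"

definition flowers :: "'a::euclidean_space set set" where
  "flowers = {F. star_body F \<and>
     (\<exists>C. C \<noteq> {} \<and> closed C \<and> F = radial_closure (\<Union>x\<in>C. diameter_ball x))}"

definition support_function :: "'a::euclidean_space set \<Rightarrow> 'a \<Rightarrow> ereal" where
  "support_function K \<theta> = (SUP y\<in>K. ereal (y \<bullet> \<theta>))"

text \<open>The conversion \<open>e2ennreal\<close> is only a change of type here: support functions of members of
  \<open>K0\<close> are non-negative.\<close>

definition flower :: "'a::euclidean_space set \<Rightarrow> 'a set" where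
  "flower K = star_body_of (\<lambda>\<theta>. e2ennreal (support_function K \<theta>))"

definition radial_dist :: "'a::euclidean_space \<Rightarrow> 'a set \<Rightarrow> real" where
  "radial_dist x A = Inf {\<alpha>. 0 < \<alpha> \<and> x \<in> radial_sum A (cball 0 \<alpha>)}"

text \<open>The real-valued infima and suprema below are over non-empty bounded sets,
  so they are the usual ones.\<close>

definition radial_AW_dist :: "'a::euclidean_space set \<Rightarrow> 'a set \<Rightarrow> real" where
  "radial_AW_dist A B =
     (SUP j\<in>{1::nat..}. min (1 / real j) (SUP x\<in>cball 0 (real j). \<bar>radial_dist x A - radial_dist x B\<bar>))"

definition AW_dist :: "'a::euclidean_space set \<Rightarrow> 'a set \<Rightarrow> real" where
  "AW_dist A B =
     (SUP j\<in>{1::nat..}. min (1 / real j) (SUP x\<in>ball 0 (real j). \<bar>infdist x A - infdist x B\<bar>))"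

lemma ex_unit_vector: "\<exists>\<theta>::'a::euclidean_space. norm \<theta> = 1"
  using vector_choose_size[of 1] by auto

lemma star_body_mem_iff:
  assumes "star_body A" "norm \<theta> = 1" "0 \<le> t"
  shows "t *\<^sub>R \<theta> \<in> A \<longleftrightarrow> ennreal t \<le> radial_function A \<theta>"
proof
  assume "t *\<^sub>R \<theta> \<in> A"
  then show "ennreal t \<le> radial_function A \<theta>"
    unfolding radial_function_def using assms by (intro SUP_upper) auto
next
  assume le: "ennreal t \<le> radial_function A \<theta>"
  show "t *\<^sub>R \<theta> \<in> A"
  proof (cases "ennreal t < radial_function A \<theta>")
    case True
    then obtain l where l: "0 \<le> l" "l *\<^sub>R \<theta> \<in> A" "ennreal t < ennreal l"
      unfolding radial_function_def less_SUP_iff by auto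
    then have "t < l" by (simp add: ennreal_less_iff assms)
    then have "0 \<le> t / l \<and> t / l \<le> 1" using assms(3) by simp
    then have "(t / l) *\<^sub>R (l *\<^sub>R \<theta>) \<in> A"
      using assms(1) l(2) unfolding star_body_def star_set_def by blast
    then show ?thesis using \<open>t < l\<close> assms(3) by simp
  next
    case False
    then have eq: "radial_function A \<theta> = ennreal t" using le by auto
    then have "enn2real (radial_function A \<theta>) *\<^sub>R \<theta> \<in> A"
    proof -
      have "\<theta> \<in> sphere 0 1" "radial_function A \<theta> < top" using assms(2) eq by auto
      then show ?thesis using assms(1) unfolding star_body_def by blast
    qed
    then show ?thesis using eq assms by simp
  qed
qed

lemma star_set_0: "star_set A \<Longrightarrow> 0 \<in> A"
proof -
  assume A: "star_set A"
  then obtain a where "a \<in> A" unfolding star_set_def by blast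
  then have "0 *\<^sub>R a \<in> A"
    using A unfolding star_set_def by (metis order_refl zero_le_one)
  then show "0 \<in> A" by simp
qed

lemma star_body_mem_iff_norm:
  assumes "star_body A"
  shows "x \<in> A \<longleftrightarrow> x = 0 \<or> ennreal (norm x) \<le> radial_function A (sgn x)"
proof (cases "x = 0")
  case True
  then show ?thesis using star_set_0 assms by (auto simp: star_body_def)
next
  case False
  then show ?thesis
    using star_body_mem_iff[OF assms, of "sgn x" "norm x"] by (simp add: norm_sgn sgn_div_norm)
qed

lemma star_body_eqI:
  assumes "star_body A" "star_body B"
    and "\<And>\<theta>. norm \<theta> = 1 \<Longrightarrow> radial_function A \<theta> = radial_function B \<theta>"
  shows "A = B"
proof (rule set_eqI)
  fix x
  show "x \<in> A \<longleftrightarrow> x \<in> B"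
    unfolding star_body_mem_iff_norm[OF assms(1), of x] star_body_mem_iff_norm[OF assms(2), of x]
    using assms(3)[of "sgn x"] by (cases "x = 0") (simp_all add: norm_sgn)
qed

lemma SUP_ennreal_le: "(SUP l\<in>{l. 0 \<le> l \<and> ennreal l \<le> c}. ennreal l) = c"
proof (rule antisym)
  show "(SUP l\<in>{l. 0 \<le> l \<and> ennreal l \<le> c}. ennreal l) \<le> c" by (rule SUP_least) auto
  show "c \<le> (SUP l\<in>{l. 0 \<le> l \<and> ennreal l \<le> c}. ennreal l)"
  proof (cases c rule: ennreal_cases)
    case (real r)
    then show ?thesis by (auto intro!: SUP_upper2[of r])
  next
    case top
    have "of_nat n \<le> (SUP l\<in>{l. 0 \<le> l \<and> ennreal l \<le> c}. ennreal l)" for n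
      by (rule SUP_upper2[of "real n"]) (auto simp: top ennreal_of_nat_eq_real_of_nat)
    then have "(SUP n. of_nat n) \<le> (SUP l\<in>{l. 0 \<le> l \<and> ennreal l \<le> c}. ennreal l)"
      by (rule SUP_least)
    then show ?thesis unfolding ennreal_SUP_of_nat_eq_top by (rule order_trans[OF top_greatest])
  qed
qed

lemma star_body_of_ex1:
  fixes f :: "'a::euclidean_space \<Rightarrow> ennreal"
  shows "\<exists>!A. star_body A \<and> (\<forall>\<theta>\<in>sphere 0 1. radial_function A \<theta> = f \<theta>)"
proof (rule ex_ex1I)
  define A where "A = {x. x = 0 \<or> ennreal (norm x) \<le> f (sgn x)}"
  have mem: "l *\<^sub>R \<theta> \<in> A \<longleftrightarrow> ennreal l \<le> f \<theta>" if "norm \<theta> = 1" "0 \<le> l" for l \<theta>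
    using that by (cases "l = 0") (auto simp: A_def sgn_scaleR sgn_div_norm)
  have rad: "radial_function A \<theta> = f \<theta>" if "norm \<theta> = 1" for \<theta>
  proof -
    have "{l. 0 \<le> l \<and> l *\<^sub>R \<theta> \<in> A} = {l. 0 \<le> l \<and> ennreal l \<le> f \<theta>}"
      using mem[OF that] by auto
    then show ?thesis unfolding radial_function_def by (simp add: SUP_ennreal_le)
  qed
  have "t *\<^sub>R x \<in> A" if "x \<in> A" "0 \<le> t" "t \<le> 1" for t x
  proof (cases "t = 0 \<or> x = 0")
    case False
    then have "ennreal (norm x) \<le> f (sgn x)" using that by (auto simp: A_def)
    moreover have "ennreal (norm (t *\<^sub>R x)) \<le> ennreal (norm x)"
      using that by (intro ennreal_leI) (simp add: mult_left_le_one_le)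
    ultimately have "ennreal (norm (t *\<^sub>R x)) \<le> f (sgn x)" by (rule order_trans[rotated])
    then show ?thesis using False that by (simp add: A_def sgn_scaleR)
  qed (auto simp: A_def)
  then have "star_set A" unfolding star_set_def by (auto simp: A_def)
  moreover have "enn2real (radial_function A \<theta>) *\<^sub>R \<theta> \<in> A"
    if "\<theta> \<in> sphere 0 1" "radial_function A \<theta> < top" for \<theta>
    using that by (subst mem) (auto simp: rad ennreal_enn2real_if)
  ultimately have "star_body A" unfolding star_body_def by blast
  then show "\<exists>A. star_body A \<and> (\<forall>\<theta>\<in>sphere 0 1. radial_function A \<theta> = f \<theta>)"
    using rad by (intro exI[of _ A]) auto
next
  fix A B
  assume "star_body A \<and> (\<forall>\<theta>\<in>sphere 0 1. radial_function A \<theta> = f \<theta>)"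
    and "star_body B \<and> (\<forall>\<theta>\<in>sphere 0 1. radial_function B \<theta> = f \<theta>)"
  then show "A = B" by (intro star_body_eqI) auto
qed

lemma star_body_star_body_of: "star_body (star_body_of f)"
  and radial_function_star_body_of: "norm \<theta> = 1 \<Longrightarrow> radial_function (star_body_of f) \<theta> = f \<theta>"
  using theI'[OF star_body_of_ex1, of f] unfolding star_body_of_def by auto

lemma mem_star_body_of: "x \<in> star_body_of f \<longleftrightarrow> x = 0 \<or> ennreal (norm x) \<le> f (sgn x)"
  using star_body_mem_iff_norm[OF star_body_star_body_of, of x f]
    radial_function_star_body_of[of "sgn x" f]
  by (cases "x = 0") (auto simp: norm_sgn)

lemma star_body_K0:
  assumes "K \<in> K0"
  shows "star_body K"
  unfolding star_body_def
proof (intro conjI ballI impI)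
  have K: "closed K" "convex K" "0 \<in> K" using assms by (auto simp: K0_def)
  have scale: "t *\<^sub>R x \<in> K" if "x \<in> K" "0 \<le> t" "t \<le> 1" for t x
    using convexD_alt[OF K(2,3) that(1), of t] that by simp
  then show "star_set K" unfolding star_set_def using K by auto
  fix \<theta> :: 'a assume \<theta>: "\<theta> \<in> sphere 0 1" and fin: "radial_function K \<theta> < top"
  define r where "r = enn2real (radial_function K \<theta>)"
  have r: "radial_function K \<theta> = ennreal r" "0 \<le> r"
    using fin by (auto simp: r_def)
  have below: "t *\<^sub>R \<theta> \<in> K" if "0 \<le> t" "t < r" for t
  proof -
    have "ennreal t < radial_function K \<theta>" using that r by (simp add: ennreal_less_iff)
    then obtain l where l: "0 \<le> l" "l *\<^sub>R \<theta> \<in> K" "ennreal t < ennreal l"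
      unfolding radial_function_def less_SUP_iff by auto
    then have "t < l" using that by (simp add: ennreal_less_iff)
    have "(t / l) *\<^sub>R (l *\<^sub>R \<theta>) \<in> K" by (rule scale[OF l(2)]) (use that l \<open>t < l\<close> in auto)
    then show ?thesis using \<open>t < l\<close> that by simp
  qed
  have "r *\<^sub>R \<theta> \<in> K"
  proof (cases "r = 0")
    case False
    have "(\<lambda>n. (r * (1 - inverse (real (Suc n)))) *\<^sub>R \<theta>) \<longlonglongrightarrow> (r * (1 - 0)) *\<^sub>R \<theta>"
      by (intro tendsto_intros LIMSEQ_inverse_real_of_nat)
    moreover have "(r * (1 - inverse (real (Suc n)))) *\<^sub>R \<theta> \<in> K" for n
      using r False by (intro below) (auto simp: field_simps)
    ultimately show ?thesis using closed_sequentially[OF K(1)] by force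
  qed (use K in auto)
  then show "enn2real (radial_function K \<theta>) *\<^sub>R \<theta> \<in> K" by (simp add: r_def)
qed

lemma flower_in_flowers:
  assumes "K \<in> K0"
  shows "flower K \<in> flowers"
proof -
  have K: "closed K" "0 \<in> K" using assms by (auto simp: K0_def)
  have ball: "l *\<^sub>R \<theta> \<in> diameter_ball x \<longleftrightarrow> l = 0 \<or> l \<le> x \<bullet> \<theta>"
    if "norm \<theta> = 1" "0 \<le> l" for l x and \<theta> :: 'a
  proof -
    have "l *\<^sub>R \<theta> \<in> diameter_ball x \<longleftrightarrow> (norm (x /\<^sub>R 2 - l *\<^sub>R \<theta>))\<^sup>2 \<le> (norm x / 2)\<^sup>2"
      by (simp add: diameter_ball_def dist_norm abs_le_square_iff[symmetric])
    also have "(norm (x /\<^sub>R 2 - l *\<^sub>R \<theta>))\<^sup>2 = (norm x / 2)\<^sup>2 - l * (x \<bullet> \<theta>) + l * l * (\<theta> \<bullet> \<theta>)"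
      by (simp add: power2_norm_eq_inner inner_diff inner_commute power_divide)
    also have "\<theta> \<bullet> \<theta> = 1" using that by (simp add: norm_eq_1)
    finally show ?thesis using that by (auto simp: mult_le_cancel_left)
  qed
  have "radial_function (\<Union>x\<in>K. diameter_ball x) \<theta> = e2ennreal (support_function K \<theta>)"
    if \<theta>: "norm \<theta> = 1" for \<theta>
  proof (rule antisym)
    have up: "ennreal (x \<bullet> \<theta>) \<le> e2ennreal (support_function K \<theta>)" if "x \<in> K" for x
      unfolding e2ennreal_ereal[symmetric] support_function_def
      by (intro e2ennreal_mono SUP_upper that)
    show "radial_function (\<Union>x\<in>K. diameter_ball x) \<theta> \<le> e2ennreal (support_function K \<theta>)"
      unfolding radial_function_def
    proof (rule SUP_least)
      fix l assume "l \<in> {l. 0 \<le> l \<and> l *\<^sub>R \<theta> \<in> (\<Union>x\<in>K. diameter_ball x)}"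
      then obtain x where "x \<in> K" "0 \<le> l" "l = 0 \<or> l \<le> x \<bullet> \<theta>" using ball[OF \<theta>] by auto
      then show "ennreal l \<le> e2ennreal (support_function K \<theta>)"
        using order_trans[OF ennreal_leI up] by (cases "l = 0") simp_all
    qed
    have "ereal (x \<bullet> \<theta>) \<le> enn2ereal (radial_function (\<Union>x\<in>K. diameter_ball x) \<theta>)"
      if "x \<in> K" for x
    proof (cases "0 \<le> x \<bullet> \<theta>")
      case True
      then have "ennreal (x \<bullet> \<theta>) \<le> radial_function (\<Union>x\<in>K. diameter_ball x) \<theta>"
        unfolding radial_function_def using ball[OF \<theta> True, of x] that by (intro SUP_upper) auto
      then show ?thesis using True by (simp add: less_eq_ennreal.rep_eq enn2ereal_ennreal)
    next
      case False
      then have "ereal (x \<bullet> \<theta>) \<le> 0" by simp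
      also note enn2ereal_nonneg
      finally show ?thesis .
    qed
    then have "support_function K \<theta> \<le> enn2ereal (radial_function (\<Union>x\<in>K. diameter_ball x) \<theta>)"
      unfolding support_function_def by (rule SUP_least)
    from e2ennreal_mono[OF this]
    show "e2ennreal (support_function K \<theta>) \<le> radial_function (\<Union>x\<in>K. diameter_ball x) \<theta>"
      by simp
  qed
  then have "flower K = radial_closure (\<Union>x\<in>K. diameter_ball x)"
    unfolding flower_def radial_closure_def
    by (intro star_body_eqI) (simp_all add: star_body_star_body_of radial_function_star_body_of)
  moreover have "star_body (flower K)" unfolding flower_def by (rule star_body_star_body_of)
  ultimately show ?thesis unfolding flowers_def using K by blast
qed

lemma radial_function_cball:
  assumes "norm \<theta> = 1" "0 \<le> \<alpha>"
  shows "radial_function (cball 0 \<alpha>) \<theta> = ennreal \<alpha>"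
proof -
  have "{l. 0 \<le> l \<and> l *\<^sub>R \<theta> \<in> cball 0 \<alpha>} = {l. 0 \<le> l \<and> ennreal l \<le> ennreal \<alpha>}"
    using assms by (auto simp: ennreal_le_iff)
  then show ?thesis unfolding radial_function_def by (simp only: SUP_ennreal_le)
qed

lemma mem_radial_sum_cball:
  assumes "0 < \<alpha>"
  shows "x \<in> radial_sum A (cball 0 \<alpha>) \<longleftrightarrow>
    x = 0 \<or> ennreal (norm x) \<le> radial_function A (sgn x) + ennreal \<alpha>"
  using assms
  by (cases "x = 0") (simp_all add: radial_sum_def mem_star_body_of radial_function_cball norm_sgn)

lemma radial_dist_set:
  "{\<alpha>. 0 < \<alpha> \<and> x \<in> radial_sum A (cball 0 \<alpha>)} =
   {\<alpha>. 0 < \<alpha> \<and> (x = 0 \<or> ennreal (norm x) \<le> radial_function A (sgn x) + ennreal \<alpha>)}"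
  using mem_radial_sum_cball by auto

lemma radial_dist_nonneg: "0 \<le> radial_dist x A"
  and radial_dist_le: "radial_dist x A \<le> norm x"
proof -
  let ?S = "{\<alpha>. 0 < \<alpha> \<and> x \<in> radial_sum A (cball 0 \<alpha>)}"
  have "norm x + 1 \<in> ?S" unfolding radial_dist_set
    by (auto intro!: add_increasing ennreal_leI add_nonneg_pos)
  then show "0 \<le> radial_dist x A" unfolding radial_dist_def by (intro cInf_greatest) auto
  have "norm x + e \<in> ?S" if "0 < e" for e :: real
    unfolding radial_dist_set using that
    by (auto intro!: add_increasing ennreal_leI add_nonneg_pos)
  moreover have "bdd_below ?S" by (intro bdd_belowI[of _ 0]) auto
  ultimately have "radial_dist x A \<le> norm x + e" if "0 < e" for e
    unfolding radial_dist_def using that by (intro cInf_lower) auto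
  then show "radial_dist x A \<le> norm x" by (rule field_le_epsilon)
qed

lemma radial_dist_eq_0_iff:
  assumes "star_body A"
  shows "radial_dist x A = 0 \<longleftrightarrow> x \<in> A"
proof -
  let ?S = "{\<alpha>. 0 < \<alpha> \<and> x \<in> radial_sum A (cball 0 \<alpha>)}"
  have bdd: "bdd_below ?S" by (intro bdd_belowI[of _ 0]) auto
  have ne: "?S \<noteq> {}"
  proof -
    have "norm x + 1 \<in> ?S" unfolding radial_dist_set
      by (auto intro!: add_increasing ennreal_leI add_nonneg_pos)
    then show ?thesis by blast
  qed
  show ?thesis
  proof
    assume 0: "radial_dist x A = 0"
    have "ennreal (norm x) \<le> radial_function A (sgn x) + ennreal e" if "x \<noteq> 0" "0 < e" for e
    proof -
      have "Inf ?S < e" using 0 that by (simp add: radial_dist_def)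
      then obtain \<alpha> where "\<alpha> \<in> ?S" "\<alpha> < e" using cInf_less_iff[OF ne bdd] by auto
      then show ?thesis using that unfolding radial_dist_set
        by (auto intro: order_trans add_left_mono ennreal_leI)
    qed
    then show "x \<in> A"
      unfolding star_body_mem_iff_norm[OF assms] by (blast intro: ennreal_le_epsilon)
  next
    assume "x \<in> A"
    then have "x = 0 \<or> ennreal (norm x) \<le> radial_function A (sgn x)"
      using star_body_mem_iff_norm[OF assms] by blast
    then have "e \<in> ?S" if "0 < e" for e
      unfolding radial_dist_set using that by (auto intro: order_trans)
    then have "radial_dist x A \<le> 0 + e" if "0 < e" for e
      unfolding radial_dist_def using that bdd by (auto intro!: cInf_lower)
    then show "radial_dist x A = 0"
      using radial_dist_nonneg[of x A] field_le_epsilon[of "radial_dist x A" 0] by force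
  qed
qed

lemma Metric_space_SUP_min:
  fixes D :: "'x \<Rightarrow> 'b \<Rightarrow> real" and S :: "nat \<Rightarrow> 'x set"
  assumes bdd: "\<And>A B j. bdd_above ((\<lambda>x. \<bar>D x A - D x B\<bar>) ` S j)"
    and ne: "\<And>j. 1 \<le> j \<Longrightarrow> S j \<noteq> {}"
    and sep: "\<And>A B. A \<in> M \<Longrightarrow> B \<in> M \<Longrightarrow> (\<And>j x. 1 \<le> j \<Longrightarrow> x \<in> S j \<Longrightarrow> D x A = D x B) \<Longrightarrow> A = B"
  shows "Metric_space M
    (\<lambda>A B. SUP j\<in>{1::nat..}. min (1 / real j) (SUP x\<in>S j. \<bar>D x A - D x B\<bar>))"
proof -
  define s where "s = (\<lambda>A B j. SUP x\<in>S j. \<bar>D x A - D x B\<bar>)"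
  define d where "d = (\<lambda>A B. SUP j\<in>{1::nat..}. min (1 / real j) (s A B j))"
  have s_up: "\<bar>D x A - D x B\<bar> \<le> s A B j" if "x \<in> S j" for x A B j
    unfolding s_def by (rule cSUP_upper[OF that bdd])
  have s_nonneg: "0 \<le> s A B j" if "1 \<le> j" for A B j
  proof -
    obtain x where "x \<in> S j" using ne[OF \<open>1 \<le> j\<close>] by auto
    then have "\<bar>D x A - D x B\<bar> \<le> s A B j" by (rule s_up)
    then show ?thesis by linarith
  qed
  have d_bdd: "bdd_above ((\<lambda>j. min (1 / real j) (s A B j)) ` {1..})" for A B
  proof (intro bdd_aboveI[of _ 1])
    fix y assume "y \<in> (\<lambda>j. min (1 / real j) (s A B j)) ` {1..}"
    then obtain j :: nat where "1 \<le> j" "y = min (1 / real j) (s A B j)" by auto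
    moreover have "1 / real j \<le> 1" using \<open>1 \<le> j\<close> by simp
    ultimately show "y \<le> 1" by linarith
  qed
  have d_up: "min (1 / real j) (s A B j) \<le> d A B" if "1 \<le> j" for A B j
    unfolding d_def using that by (intro cSUP_upper d_bdd) auto
  have "Metric_space M d"
  proof
    show nonneg: "0 \<le> d A B" for A B
    proof -
      have "0 \<le> min (1 / real 1) (s A B 1)" using s_nonneg[of 1] by simp
      also have "\<dots> \<le> d A B" by (rule d_up) simp
      finally show ?thesis .
    qed
    show "d A B = d B A" for A B
      unfolding d_def s_def by (simp add: abs_minus_commute)
    show "d A B = 0 \<longleftrightarrow> A = B" if "A \<in> M" "B \<in> M" for A B
    proof
      assume 0: "d A B = 0"
      show "A = B"
      proof (rule sep[OF that])
        fix j x assume j: "1 \<le> j" and "x \<in> S j"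
        have "min (1 / real j) (s A B j) \<le> 0" using d_up[OF j, of A B] 0 by simp
        moreover have "0 < 1 / real j" using j by simp
        ultimately have "s A B j \<le> 0" by linarith
        then show "D x A = D x B" using s_up[OF \<open>x \<in> S j\<close>, of A B] by linarith
      qed
    next
      assume "A = B"
      have "s A A j = 0" if "1 \<le> j" for j
        unfolding s_def using ne[OF that] by simp
      then have "d A A = (SUP j\<in>{1::nat..}. 0)" unfolding d_def by (intro SUP_cong) auto
      then show "d A B = 0" using \<open>A = B\<close> by simp
    qed
    show "d A C \<le> d A B + d B C" for A B C
      unfolding d_def
    proof (rule cSUP_least)
      fix j :: nat assume "j \<in> {1..}"
      then have j: "1 \<le> j" by simp
      have "s A C j \<le> s A B j + s B C j"
        unfolding s_def
      proof (rule cSUP_least[OF ne[OF j]])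
        fix x assume "x \<in> S j"
        then have "\<bar>D x A - D x B\<bar> \<le> s A B j" "\<bar>D x B - D x C\<bar> \<le> s B C j" using s_up by auto
        then show "\<bar>D x A - D x C\<bar> \<le> (SUP x\<in>S j. \<bar>D x A - D x B\<bar>) + (SUP x\<in>S j. \<bar>D x B - D x C\<bar>)"
          unfolding s_def by linarith
      qed
      then have "min (1 / real j) (s A C j) \<le> min (1 / real j) (s A B j) + min (1 / real j) (s B C j)"
        using s_nonneg[OF j, of A B] s_nonneg[OF j, of B C] zero_le_divide_1_iff[of "real j"]
        of_nat_0_le_iff[of j] by linarith
      also have "\<dots> \<le> d A B + d B C" by (intro add_mono d_up j)
      finally show "min (1 / real j) (s A C j) \<le>
         (SUP j\<in>{1..}. min (1 / real j) (s A B j)) + (SUP j\<in>{1..}. min (1 / real j) (s B C j))"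
        unfolding d_def .
    qed auto
  qed
  then show ?thesis unfolding d_def s_def .
qed

lemma Metric_space_radial_AW_dist: "Metric_space {A. star_body A} radial_AW_dist"
  unfolding radial_AW_dist_def[abs_def]
proof (rule Metric_space_SUP_min)
  fix A B :: "'a set" and j :: nat
  show "bdd_above ((\<lambda>x. \<bar>radial_dist x A - radial_dist x B\<bar>) ` cball 0 (real j))"
  proof (intro bdd_aboveI2[of _ _ "real j"])
    fix x :: 'a assume "x \<in> cball 0 (real j)"
    then show "\<bar>radial_dist x A - radial_dist x B\<bar> \<le> real j"
      using radial_dist_nonneg[of x A] radial_dist_nonneg[of x B]
        radial_dist_le[of x A] radial_dist_le[of x B] by auto
  qed
next
  fix A B :: "'a set"
  assume AB: "A \<in> {A. star_body A}" "B \<in> {A. star_body A}"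
    and eq: "\<And>j x. 1 \<le> j \<Longrightarrow> x \<in> cball 0 (real j) \<Longrightarrow> radial_dist x A = radial_dist x B"
  have "radial_dist x A = radial_dist x B" for x
  proof -
    obtain n where "norm x \<le> real n" using real_arch_simple by blast
    then show ?thesis by (intro eq[of "Suc n"]) auto
  qed
  then show "A = B"
    using AB radial_dist_eq_0_iff[of A] radial_dist_eq_0_iff[of B] by (intro set_eqI) simp
qed auto

lemma Metric_space_AW_dist:
  "Metric_space {C::'a::euclidean_space set. closed C \<and> C \<noteq> {}} AW_dist"
  unfolding AW_dist_def[abs_def]
proof (rule Metric_space_SUP_min)
  fix A B :: "'a set" and j :: nat
  show "bdd_above ((\<lambda>x. \<bar>infdist x A - infdist x B\<bar>) ` ball 0 (real j))"
  proof (intro bdd_aboveI2[of _ _ "2 * real j + infdist 0 A + infdist 0 B"])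
    fix x :: 'a assume "x \<in> ball 0 (real j)"
    then show "\<bar>infdist x A - infdist x B\<bar> \<le> 2 * real j + infdist 0 A + infdist 0 B"
      using infdist_triangle[of x A 0] infdist_triangle[of x B 0]
        infdist_nonneg[of x A] infdist_nonneg[of x B] infdist_nonneg[of 0 A] infdist_nonneg[of 0 B]
      by (auto simp: dist_norm)
  qed
next
  fix A B :: "'a set"
  assume AB: "A \<in> {C. closed C \<and> C \<noteq> {}}" "B \<in> {C. closed C \<and> C \<noteq> {}}"
    and eq: "\<And>j x. 1 \<le> j \<Longrightarrow> x \<in> ball 0 (real j) \<Longrightarrow> infdist x A = infdist x B"
  have "infdist x A = infdist x B" for x
  proof -
    obtain n where "norm x \<le> real n" using real_arch_simple by blast
    then show ?thesis by (intro eq[of "Suc n"]) auto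
  qed
  then show "A = B"
    using AB in_closed_iff_infdist_zero[of A] in_closed_iff_infdist_zero[of B]
    by (intro set_eqI) simp
qed auto

lemma Metric_space_K0_radial_AW: "Metric_space K0 radial_AW_dist"
  and Metric_space_flowers_radial_AW: "Metric_space flowers radial_AW_dist"
  and Metric_space_K0_AW: "Metric_space K0 AW_dist"
proof -
  show "Metric_space K0 radial_AW_dist"
    by (rule Metric_space.subspace[OF Metric_space_radial_AW_dist]) (auto simp: star_body_K0)
  show "Metric_space flowers radial_AW_dist"
    by (rule Metric_space.subspace[OF Metric_space_radial_AW_dist]) (auto simp: flowers_def)
  show "Metric_space K0 AW_dist"
    by (rule Metric_space.subspace[OF Metric_space_AW_dist]) (auto simp: K0_def)
qed

end

theory Submission
  imports Defs
begin

text \<open>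
  Inverting the radial function, \<open>\<rho> \<mapsto> 1 / \<rho>\<close>, turns the flower generated by \<open>C\<close> into the polar
  of \<open>C\<close>, so by the bipolar theorem it is a bijection between \<open>K0\<close> and the flowers. Convergence for
  \<open>radial_AW_dist\<close> is convergence of the truncations \<open>min j \<rho>\<close>, uniformly on the sphere for each \<open>j\<close>,
  that is, uniform convergence for the compact uniformity of \<open>[0, \<infinity>]\<close>; as \<open>r \<mapsto> 1 / r\<close> is
  uniformly continuous for it, the inversion is a homeomorphism.

  The flower map is discontinuous at a ray: the initial segments of the ray converge to it, but
  close to the hyperplane orthogonal to the ray their support functions stay small, while the support
  function of the ray is already infinite.
\<close>

section \<open>Radial distances through truncated radial functions\<close>

text \<open>The minimum is formed in \<open>ennreal\<close>, where it is finite for every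
  \<open>a\<close>, so the default value of \<open>enn2real\<close> at \<open>top\<close> never
  enters.\<close>

definition truncate :: "real \<Rightarrow> ennreal \<Rightarrow> real" where
  "truncate t a = enn2real (min (ennreal t) a)"

lemma truncate_ennreal: "0 \<le> t \<Longrightarrow> 0 \<le> r \<Longrightarrow> truncate t (ennreal r) = min t r"
  by (simp add: truncate_def min_def)

lemma truncate_top [simp]: "0 \<le> t \<Longrightarrow> truncate t top = t"
  by (simp add: truncate_def)

lemma truncate_truncate:
  assumes "0 \<le> t" "t \<le> u"
  shows "truncate t a = min t (truncate u a)"
  using assms by (cases a rule: ennreal_cases) (auto simp: truncate_ennreal)

text \<open>For t > 0 the point \<open>t *\<^sub>R \<theta>\<close> lies in the radial sum with a
  ball of radius \<alpha> iff the radial function plus \<alpha> reaches t. So the infimum of such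
  \<alpha> is the positive part of t minus the radial function.\<close>

lemma radial_dist_eq_truncate:
  assumes "norm \<theta> = 1" "0 \<le> t"
  shows "radial_dist (t *\<^sub>R \<theta>) A = t - truncate t (radial_function A \<theta>)"
proof (cases "t = 0")
  case True
  then show ?thesis
    using radial_dist_nonneg[of 0 A] radial_dist_le[of 0 A] by (simp add: truncate_def)
next
  case False
  let ?S = "{\<alpha>. 0 < \<alpha> \<and> t *\<^sub>R \<theta> \<in> radial_sum A (cball 0 \<alpha>)}"
  have sgn: "sgn (t *\<^sub>R \<theta>) = \<theta>" "norm (t *\<^sub>R \<theta>) = t" "t *\<^sub>R \<theta> \<noteq> 0"
    using assms False by (auto simp: sgn_scaleR sgn_div_norm)
  have "?S = {\<alpha>. 0 < \<alpha> \<and> t - truncate t (radial_function A \<theta>) \<le> \<alpha>}"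
  proof (cases "radial_function A \<theta>" rule: ennreal_cases)
    case (real r)
    then show ?thesis
      unfolding radial_dist_set sgn using assms False
      by (auto simp: truncate_ennreal simp flip: ennreal_plus)
  next
    case top
    then show ?thesis unfolding radial_dist_set sgn using assms by auto
  qed
  \<comment> \<open>Requiring \<alpha> > 0 only drops the point 0 when c = 0, which leaves the
    infimum unchanged.\<close>
  moreover have "Inf {\<alpha>::real. 0 < \<alpha> \<and> c \<le> \<alpha>} = c" if "0 \<le> c" for c
  proof (cases "c = 0")
    case True
    then have "{\<alpha>::real. 0 < \<alpha> \<and> c \<le> \<alpha>} = {0<..}" by auto
    then show ?thesis using True by simp
  next
    case False
    then have "{\<alpha>::real. 0 < \<alpha> \<and> c \<le> \<alpha>} = {c..}" using that by auto
    then show ?thesis by simp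
  qed
  moreover have "truncate t (radial_function A \<theta>) \<le> t"
    using truncate_truncate[of t t] assms by (metis min.cobounded1 order_refl)
  ultimately show ?thesis by (simp add: radial_dist_def)
qed

lemma radial_dist_diff_le_norm: "\<bar>radial_dist x A - radial_dist x B\<bar> \<le> norm x"
  using radial_dist_nonneg[of x A] radial_dist_nonneg[of x B]
    radial_dist_le[of x A] radial_dist_le[of x B] by linarith

text \<open>The supremum over the ball is tested at the single point
  \<open>real j *\<^sub>R \<theta>\<close>, where both radial distances are j minus a
  truncation.\<close>

lemma radial_AW_dist_ge:
  fixes A B :: "'a::euclidean_space set"
  assumes "norm \<theta> = 1" "1 \<le> j"
  shows "min (1 / real j)
      \<bar>truncate (real j) (radial_function A \<theta>) - truncate (real j) (radial_function B \<theta>)\<bar>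
    \<le> radial_AW_dist A B"
proof -
  let ?s = "\<lambda>j. SUP x\<in>cball 0 (real j). \<bar>radial_dist x A - radial_dist x B\<bar>"
  have "\<bar>radial_dist (real j *\<^sub>R \<theta>) A - radial_dist (real j *\<^sub>R \<theta>) B\<bar> \<le> ?s j"
  proof (rule cSUP_upper)
    show "bdd_above ((\<lambda>x. \<bar>radial_dist x A - radial_dist x B\<bar>) ` cball 0 (real j))"
      by (intro bdd_aboveI2[of _ _ "real j"] order_trans[OF radial_dist_diff_le_norm]) auto
  qed (use assms in auto)
  moreover have "min (1 / real j) (?s j) \<le> radial_AW_dist A B"
    unfolding radial_AW_dist_def
  proof (rule cSUP_upper)
    show "bdd_above ((\<lambda>j. min (1 / real j) (?s j)) ` {1..})"
      by (intro bdd_aboveI2[of _ _ 1]) (auto intro: min.coboundedI1)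
  qed (use assms in auto)
  ultimately show ?thesis
    using assms by (simp add: radial_dist_eq_truncate abs_minus_commute)
qed

text \<open>One level N controls all indices: those above N contribute at most 1 / N, and for the
  others the truncation at \<open>norm x\<close> <= N is a 1-Lipschitz function of the truncation at
  N.\<close>

lemma radial_AW_dist_le:
  fixes A B :: "'a::euclidean_space set"
  assumes "1 \<le> N" "1 / real N \<le> c"
    and le: "\<And>\<theta>. norm \<theta> = 1 \<Longrightarrow>
      \<bar>truncate (real N) (radial_function A \<theta>) - truncate (real N) (radial_function B \<theta>)\<bar> \<le> c"
  shows "radial_AW_dist A B \<le> c"
  unfolding radial_AW_dist_def
proof (rule cSUP_least)
  fix j :: nat assume "j \<in> {1..}"
  then have j: "1 \<le> j" by simp
  show "min (1 / real j) (SUP x\<in>cball 0 (real j). \<bar>radial_dist x A - radial_dist x B\<bar>) \<le> c"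
  proof (cases "j \<le> N")
    case False
    then have "1 / real j \<le> 1 / real N" using assms by (intro divide_left_mono) auto
    then show ?thesis using assms by linarith
  next
    case True
    have "(SUP x\<in>cball 0 (real j). \<bar>radial_dist x A - radial_dist x B\<bar>) \<le> c"
    proof (rule cSUP_least)
      fix x :: 'a assume x: "x \<in> cball 0 (real j)"
      \<comment> \<open>The origin has no direction of its own; any unit vector serves
        there.\<close>
      obtain \<theta> :: 'a where \<theta>: "norm \<theta> = 1" "x = norm x *\<^sub>R \<theta>"
      proof (cases "x = 0")
        case True
        then show ?thesis using that ex_unit_vector by auto
      next
        case False
        then show ?thesis using that[of "sgn x"] by (simp add: norm_sgn sgn_div_norm)
      qed
      have "norm x \<le> real N" using x True by simp
      then have "\<bar>radial_dist (norm x *\<^sub>R \<theta>) A - radial_dist (norm x *\<^sub>R \<theta>) B\<bar> \<le>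
        \<bar>truncate (real N) (radial_function A \<theta>) - truncate (real N) (radial_function B \<theta>)\<bar>"
        unfolding radial_dist_eq_truncate[OF \<theta>(1) norm_ge_zero]
          truncate_truncate[OF norm_ge_zero \<open>norm x \<le> real N\<close>] by linarith
      also have "\<dots> \<le> c" by (rule le[OF \<theta>(1)])
      finally show "\<bar>radial_dist x A - radial_dist x B\<bar> \<le> c" using \<theta>(2) by simp
    qed auto
    then show ?thesis by linarith
  qed
qed auto

section \<open>Inversion of radial functions\<close>

text \<open>Quantitative uniform continuity of r -> 1 / r: up to an error between 0 and 1 / n, the
  truncated inverse is an n^2-Lipschitz function of the truncation of the argument.\<close>

lemma truncate_inverse_diff_le:
  assumes "1 \<le> n"
  shows "\<bar>truncate n (inverse a) - truncate n (inverse b)\<bar>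
    \<le> n\<^sup>2 * \<bar>truncate n a - truncate n b\<bar> + 1 / n"
proof -
  \<comment> \<open>For s > 0 this is min n (1 / s). The cutoff at 1 / n extends it to s = 0 with
    value n and yields the Lipschitz constant n^2.\<close>
  define f where "f s = 1 / max s (1 / n)" for s
  have n: "0 < n" "1 / n \<le> n"
    using assms by (auto simp: divide_le_eq intro: order_trans[OF _ mult_mono[of 1 n 1 n]])
  \<comment> \<open>An error arises only for values above n, where \<open>f\<close> returns 1 / n
    and the true inverse lies between 0 and 1 / n. As the errors for \<open>a\<close> and
    \<open>b\<close> have the same sign, they differ by at most 1 / n.\<close>
  have approx: "0 \<le> f (truncate n a) - truncate n (inverse a) \<and>
      f (truncate n a) - truncate n (inverse a) \<le> 1 / n" for a
  proof (cases a rule: ennreal_cases)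
    case (real r)
    show ?thesis
    proof (cases "r = 0")
      case True
      then show ?thesis using n real by (simp add: f_def truncate_ennreal max_def truncate_def)
    next
      case False
      then have r: "0 < r" using real by simp
      then have "truncate n (inverse a) = min n (1 / r)" "truncate n a = min n r"
        using n real by (simp_all add: inverse_ennreal truncate_ennreal inverse_eq_divide)
      moreover have "0 \<le> f (min n r) - min n (1 / r) \<and> f (min n r) - min n (1 / r) \<le> 1 / n"
      proof (cases "n \<le> r")
        case True
        then have "1 / r \<le> 1 / n" using n by (intro divide_left_mono) auto
        then show ?thesis using True n r by (simp add: f_def)
      next
        case False
        then have "f (min n r) = min n (1 / r)"
          using n r by (auto simp: f_def min_def max_def field_simps)
        then show ?thesis using n by simp
      qed
      ultimately show ?thesis by simp
    qed
  next
    case top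
    then show ?thesis using n by (simp add: f_def max_def truncate_def)
  qed
  have lipschitz: "\<bar>f s - f t\<bar> \<le> n\<^sup>2 * \<bar>s - t\<bar>" for s t
  proof -
    define u v where "u = max s (1 / n)" and "v = max t (1 / n)"
    have uv: "1 / n \<le> u" "1 / n \<le> v" "0 < u" "0 < v"
      using n by (auto simp: u_def v_def less_max_iff_disj)
    then have inv: "1 / u \<le> n" "1 / v \<le> n" using n by (auto simp: field_simps)
    have "f s - f t = (1 / u) * (1 / v) * (v - u)"
      unfolding f_def u_def[symmetric] v_def[symmetric] using uv by (simp add: field_simps)
    then have "\<bar>f s - f t\<bar> = (1 / u) * (1 / v) * \<bar>v - u\<bar>" using uv by (simp add: abs_mult)
    also have "\<dots> \<le> n * n * \<bar>s - t\<bar>"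
      using n uv inv by (intro mult_mono) (auto simp: u_def v_def)
    finally show ?thesis by (simp add: power2_eq_square)
  qed
  show ?thesis
    using approx[of a] approx[of b] lipschitz[of "truncate n a" "truncate n b"] by linarith
qed

text \<open>Where the radial function is positive and finite, boundary points move by the spherical
  inversion x -> x / |x|^2. As \<open>inverse\<close> on \<open>ennreal\<close> exchanges 0 and
  \<open>top\<close>, no direction is excluded.\<close>

definition inversion :: "'a::euclidean_space set \<Rightarrow> 'a set" where
  "inversion A = star_body_of (\<lambda>\<theta>. inverse (radial_function A \<theta>))"

lemma star_body_inversion: "star_body (inversion A)"
  by (simp add: inversion_def star_body_star_body_of)

lemma radial_function_inversion:
  "norm \<theta> = 1 \<Longrightarrow> radial_function (inversion A) \<theta> = inverse (radial_function A \<theta>)"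
  by (simp add: inversion_def radial_function_star_body_of)

lemma inverse_inverse_ennreal: "inverse (inverse a) = (a::ennreal)"
proof (cases a rule: ennreal_cases)
  case (real r)
  then show ?thesis by (cases "r = 0") (simp_all add: inverse_ennreal)
qed simp

lemma inversion_inversion: "star_body A \<Longrightarrow> inversion (inversion A) = A"
  by (intro star_body_eqI)
    (simp_all add: star_body_inversion radial_function_inversion inverse_inverse_ennreal)

text \<open>The exponent 3 compensates the Lipschitz constant N^2: one 1 / N remains, and the
  truncation error adds another.\<close>

lemma radial_AW_dist_inversion_le:
  assumes "1 \<le> N" "radial_AW_dist A B < 1 / real N ^ 3"
  shows "radial_AW_dist (inversion A) (inversion B) \<le> 2 / real N"
proof (rule radial_AW_dist_le[OF \<open>1 \<le> N\<close>])
  show "1 / real N \<le> 2 / real N" by (simp add: divide_right_mono)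
  fix \<theta> :: 'a assume \<theta>: "norm \<theta> = 1"
  let ?d = "\<bar>truncate N (radial_function A \<theta>) - truncate N (radial_function B \<theta>)\<bar>"
  have "min (1 / real N) ?d < 1 / real N ^ 3"
    using radial_AW_dist_ge[OF \<theta> \<open>1 \<le> N\<close>, of A B] assms(2) by linarith
  \<comment> \<open>The entry 1 / N of the minimum is not below the threshold, so the difference of
    truncations must be.\<close>
  moreover have "1 / real N ^ 3 \<le> 1 / real N"
    using assms(1) by (intro divide_left_mono) (auto simp: self_le_power)
  ultimately have "?d < 1 / real N ^ 3" by linarith
  then have "(real N)\<^sup>2 * ?d \<le> (real N)\<^sup>2 * (1 / real N ^ 3)"
    by (intro mult_left_mono) auto
  also have "\<dots> = 1 / real N" using assms(1) by (simp add: field_simps power2_eq_square power3_eq_cube)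
  finally show "\<bar>truncate N (radial_function (inversion A) \<theta>) -
      truncate N (radial_function (inversion B) \<theta>)\<bar> \<le> 2 / real N"
    using truncate_inverse_diff_le[of "real N" "radial_function A \<theta>" "radial_function B \<theta>"] assms(1)
    by (simp add: radial_function_inversion[OF \<theta>])
qed

text \<open>General families \<open>S\<close> and \<open>T\<close> let one statement cover both
  directions of the homeomorphism, the map being its own inverse. The \<delta> found depends on
  \<epsilon> alone.\<close>

lemma continuous_map_inversion:
  fixes S T :: "'a::euclidean_space set set"
  assumes S: "S \<subseteq> Collect star_body" and T: "T \<subseteq> Collect star_body" and "inversion ` S \<subseteq> T"
  shows "continuous_map (Metric_space.mtopology S radial_AW_dist)
    (Metric_space.mtopology T radial_AW_dist) inversion"
proof -
  interpret S: Metric_space S radial_AW_dist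
    by (rule Metric_space.subspace[OF Metric_space_radial_AW_dist S])
  interpret T: Metric_space T radial_AW_dist
    by (rule Metric_space.subspace[OF Metric_space_radial_AW_dist T])
  show ?thesis
    unfolding S.metric_continuous_map[OF T.Metric_space_axioms]
  proof (intro conjI ballI allI impI)
    show "inversion ` S \<subseteq> T" by fact
    fix A and \<epsilon> :: real assume "A \<in> S" "0 < \<epsilon>"
    obtain n :: nat where n: "2 / \<epsilon> < real n" using reals_Archimedean2 by blast
    define N where "N = Suc n"
    have N: "2 / real N < \<epsilon>" using n \<open>0 < \<epsilon>\<close> by (simp add: N_def field_simps)
    show "\<exists>\<delta>>0. \<forall>B. B \<in> S \<and> radial_AW_dist A B < \<delta> \<longrightarrow>
        radial_AW_dist (inversion A) (inversion B) < \<epsilon>"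
    proof (intro exI[of _ "1 / real N ^ 3"] conjI allI impI)
      show "0 < 1 / real N ^ 3" by (simp add: N_def)
      fix B assume "B \<in> S \<and> radial_AW_dist A B < 1 / real N ^ 3"
      then have "radial_AW_dist (inversion A) (inversion B) \<le> 2 / real N"
        by (intro radial_AW_dist_inversion_le) (auto simp: N_def)
      then show "radial_AW_dist (inversion A) (inversion B) < \<epsilon>" using N by simp
    qed
  qed
qed

section \<open>Polarity between convex sets and flowers\<close>

definition polar :: "'a::euclidean_space set \<Rightarrow> 'a set" where
  "polar C = {y. \<forall>x\<in>C. x \<bullet> y \<le> 1}"

lemma polar_in_K0: "polar C \<in> K0"
proof -
  have eq: "polar C = (\<Inter>x\<in>C. {y. x \<bullet> y \<le> 1})" by (auto simp: polar_def)
  have "closed (polar C)" "convex (polar C)"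
    unfolding eq by (auto intro!: convex_INT closed_halfspace_le convex_halfspace_le)
  then show ?thesis by (simp add: K0_def polar_def)
qed

lemma bipolar:
  assumes "K \<in> K0"
  shows "polar (polar K) = K"
proof
  show "K \<subseteq> polar (polar K)" by (auto simp: polar_def inner_commute)
  show "polar (polar K) \<subseteq> K"
  proof
    fix z assume z: "z \<in> polar (polar K)"
    show "z \<in> K"
    proof (rule ccontr)
      assume "z \<notin> K"
      then obtain a b where ab: "a \<bullet> z < b" "\<And>x. x \<in> K \<Longrightarrow> b < a \<bullet> x"
        using separating_hyperplane_closed_point[of K z] assms by (auto simp: K0_def)
      \<comment> \<open>Dividing by the negative \<open>b\<close> reverses the inequalities: a / b
        has inner product below 1 with all of \<open>K\<close>, but above 1 with
        \<open>z\<close>.\<close>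
      have b: "b < 0" using ab(2)[of 0] assms by (simp add: K0_def)
      have "a /\<^sub>R b \<in> polar K"
        using ab(2) b by (auto simp: polar_def inner_commute divide_inverse_commute[symmetric] divide_le_eq
            intro: less_imp_le)
      then have "(a /\<^sub>R b) \<bullet> z \<le> 1" using z unfolding polar_def[of "polar K"] by blast
      then show False using ab(1) b by (simp add: divide_inverse_commute[symmetric] divide_le_eq)
    qed
  qed
qed

text \<open>Multiplying out stays valid at the endpoints because 0 * \<open>top\<close> = 0 in
  \<open>ennreal\<close>.\<close>

lemma le_inverse_ennreal_iff: "ennreal t \<le> inverse s \<longleftrightarrow> ennreal t * s \<le> 1"
proof (cases s rule: ennreal_cases)
  case (real r)
  show ?thesis
  proof (cases "r = 0 \<or> t \<le> 0")
    case False
    then show ?thesis using real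
      by (simp add: inverse_ennreal ennreal_mult[symmetric] inverse_eq_divide pos_le_divide_eq
          flip: ennreal_1)
  qed (use real in \<open>auto simp: ennreal_neg\<close>)
next
  case top
  then show ?thesis by (cases "t \<le> 0") (auto simp: ennreal_neg ennreal_mult_top top_unique)
qed

text \<open>In \<open>ennreal (x \<bullet> \<theta>)\<close> negative values are truncated to \<open>0\<close>.\<close>

lemma inversion_eq_polar:
  assumes rad: "\<And>\<theta>. norm \<theta> = 1 \<Longrightarrow> radial_function A \<theta> = (SUP x\<in>C. ennreal (x \<bullet> \<theta>))"
  shows "inversion A = polar C"
proof (rule set_eqI)
  fix y
  show "y \<in> inversion A \<longleftrightarrow> y \<in> polar C"
  proof (cases "y = 0")
    case True
    then show ?thesis by (simp add: inversion_def mem_star_body_of polar_def)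
  next
    case False
    \<comment> \<open>The bound 1 being positive, cutting negative inner products off at 0 does not
      affect the polar condition.\<close>
    have "norm y * (x \<bullet> sgn y) = x \<bullet> y" for x
      using False by (simp add: sgn_div_norm inverse_eq_divide)
    then have "ennreal (norm y) * ennreal (x \<bullet> sgn y) \<le> 1 \<longleftrightarrow> x \<bullet> y \<le> 1" for x
      by (simp flip: ennreal_mult' ennreal_1)
    then show ?thesis
      using False
      by (simp add: inversion_def mem_star_body_of rad norm_sgn le_inverse_ennreal_iff
          SUP_mult_left_ennreal SUP_le_iff polar_def)
  qed
qed

text \<open>Thales' theorem: after squaring, the terms in \<open>norm x\<close> cancel and l * l <=
  l * (x \<bullet> \<theta>) remains.\<close>

lemma scaleR_mem_diameter_ball_iff:
  assumes "norm \<theta> = 1" "0 \<le> l"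
  shows "l *\<^sub>R \<theta> \<in> diameter_ball x \<longleftrightarrow> l = 0 \<or> l \<le> x \<bullet> \<theta>"
proof -
  have "l *\<^sub>R \<theta> \<in> diameter_ball x \<longleftrightarrow> (norm (x /\<^sub>R 2 - l *\<^sub>R \<theta>))\<^sup>2 \<le> (norm x / 2)\<^sup>2"
    by (simp add: diameter_ball_def dist_norm abs_le_square_iff[symmetric])
  also have "(norm (x /\<^sub>R 2 - l *\<^sub>R \<theta>))\<^sup>2 = (norm x / 2)\<^sup>2 - l * (x \<bullet> \<theta>) + l * l * (\<theta> \<bullet> \<theta>)"
    by (simp add: power2_norm_eq_inner inner_diff inner_commute power_divide)
  also have "\<theta> \<bullet> \<theta> = 1" using assms by (simp add: norm_eq_1)
  finally show ?thesis using assms by (auto simp: mult_le_cancel_left)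
qed

lemma radial_function_UN_diameter_ball:
  assumes \<theta>: "norm \<theta> = 1"
  shows "radial_function (\<Union>x\<in>C. diameter_ball x) \<theta> = (SUP x\<in>C. ennreal (x \<bullet> \<theta>))"
proof (rule antisym)
  show "radial_function (\<Union>x\<in>C. diameter_ball x) \<theta> \<le> (SUP x\<in>C. ennreal (x \<bullet> \<theta>))"
    unfolding radial_function_def
  proof (rule SUP_least)
    fix l assume "l \<in> {l. 0 \<le> l \<and> l *\<^sub>R \<theta> \<in> (\<Union>x\<in>C. diameter_ball x)}"
    then obtain x where "x \<in> C" "0 \<le> l" "l = 0 \<or> l \<le> x \<bullet> \<theta>"
      using scaleR_mem_diameter_ball_iff[OF \<theta>] by auto
    then show "ennreal l \<le> (SUP x\<in>C. ennreal (x \<bullet> \<theta>))"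
      by (intro SUP_upper2[of x]) (auto intro: ennreal_leI)
  qed
  show "(SUP x\<in>C. ennreal (x \<bullet> \<theta>)) \<le> radial_function (\<Union>x\<in>C. diameter_ball x) \<theta>"
  proof (rule SUP_least)
    fix x assume x: "x \<in> C"
    show "ennreal (x \<bullet> \<theta>) \<le> radial_function (\<Union>x\<in>C. diameter_ball x) \<theta>"
    proof (cases "0 \<le> x \<bullet> \<theta>")
      case True
      then show ?thesis
        unfolding radial_function_def using scaleR_mem_diameter_ball_iff[OF \<theta> True, of x] x
        by (intro SUP_upper) auto
    qed (simp add: ennreal_neg)
  qed
qed

lemma inversion_flowers:
  assumes "F \<in> flowers"
  shows "inversion F \<in> K0"
proof -
  obtain C where "F = radial_closure (\<Union>x\<in>C. diameter_ball x)"
    using assms by (auto simp: flowers_def)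
  then have "inversion F = polar C"
    by (intro inversion_eq_polar)
      (simp add: radial_closure_def radial_function_star_body_of radial_function_UN_diameter_ball)
  then show ?thesis by (simp add: polar_in_K0)
qed

text \<open>A Galois connection, from which it follows that \<open>e2ennreal\<close> commutes with
  suprema.\<close>

lemma e2ennreal_le_iff_enn2ereal: "e2ennreal s \<le> u \<longleftrightarrow> s \<le> enn2ereal u"
proof
  assume le: "e2ennreal s \<le> u"
  show "s \<le> enn2ereal u"
  proof (cases "0 \<le> s")
    case True
    then show ?thesis using le by (simp add: less_eq_ennreal.rep_eq enn2ereal_e2ennreal)
  next
    case False
    then have "s \<le> 0" by simp
    also note enn2ereal_nonneg
    finally show ?thesis .
  qed
next
  assume "s \<le> enn2ereal u"
  from e2ennreal_mono[OF this] show "e2ennreal s \<le> u" by simp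
qed

text \<open>Brings the flower into the form that \<open>inversion_eq_polar\<close> expects. Both
  suprema have the same upper bounds.\<close>

lemma radial_function_flower:
  assumes "norm \<theta> = 1"
  shows "radial_function (flower K) \<theta> = (SUP x\<in>K. ennreal (x \<bullet> \<theta>))"
proof -
  have "e2ennreal (SUP x\<in>K. ereal (x \<bullet> \<theta>)) \<le> u \<longleftrightarrow> (SUP x\<in>K. ennreal (x \<bullet> \<theta>)) \<le> u" for u
    unfolding e2ennreal_le_iff_enn2ereal SUP_le_iff
    by (simp flip: e2ennreal_le_iff_enn2ereal)
  then have "e2ennreal (SUP x\<in>K. ereal (x \<bullet> \<theta>)) = (SUP x\<in>K. ennreal (x \<bullet> \<theta>))"
    by (intro antisym) blast+
  then show ?thesis
    using assms by (simp add: flower_def radial_function_star_body_of support_function_def)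
qed

text \<open>The flower of \<open>polar K\<close> inverts to the bipolar of \<open>K\<close>, which
  is \<open>K\<close>; inverting once more exhibits the inversion of \<open>K\<close> as a
  flower.\<close>

lemma inversion_K0:
  assumes "K \<in> K0"
  shows "inversion K \<in> flowers"
proof -
  have "inversion (flower (polar K)) = K"
    using inversion_eq_polar[OF radial_function_flower] bipolar[OF assms] by metis
  then have "inversion K = flower (polar K)"
    using inversion_inversion[of "flower (polar K)"] by (simp add: flower_def star_body_star_body_of)
  then show ?thesis using flower_in_flowers[OF polar_in_K0] by simp
qed

theorem K0_homeomorphic_flowers:
  "Metric_space.mtopology (K0 :: 'a::euclidean_space set set) radial_AW_dist
    homeomorphic_space Metric_space.mtopology (flowers :: 'a set set) radial_AW_dist"
proof -
  have sb: "(K0 :: 'a set set) \<subseteq> Collect star_body" "(flowers :: 'a set set) \<subseteq> Collect star_body"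
    by (auto simp: star_body_K0 flowers_def)
  have "homeomorphic_maps (Metric_space.mtopology (K0 :: 'a set set) radial_AW_dist)
    (Metric_space.mtopology (flowers :: 'a set set) radial_AW_dist) inversion inversion"
    unfolding homeomorphic_maps_def
      Metric_space.topspace_mtopology[OF Metric_space_K0_radial_AW]
      Metric_space.topspace_mtopology[OF Metric_space_flowers_radial_AW]
    using sb
    by (auto intro!: continuous_map_inversion simp: inversion_K0 inversion_flowers inversion_inversion)
  then show ?thesis by (rule homeomorphic_maps_imp_homeomorphic_space)
qed

section \<open>Discontinuity of the flower map at a ray\<close>

text \<open>Points of norm above 2 * r are at distance more than r from x, so the origin, at
  distance at most r, already beats them.\<close>

lemma infdist_Int_cball:
  fixes A :: "'a::euclidean_space set"
  assumes "0 \<in> A" "norm x \<le> r"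
  shows "infdist x (A \<inter> cball 0 (2 * r)) = infdist x A"
proof (rule antisym)
  have r: "0 \<le> r" using assms(2) norm_ge_zero[of x] by linarith
  then have 0: "0 \<in> A \<inter> cball 0 (2 * r)" using assms by simp
  have "infdist x (A \<inter> cball 0 (2 * r)) \<le> dist x a" if "a \<in> A" for a
  proof (cases "norm a \<le> 2 * r")
    case True
    then show ?thesis using that by (intro infdist_le) simp
  next
    case False
    have "infdist x (A \<inter> cball 0 (2 * r)) \<le> dist x 0" by (rule infdist_le[OF 0])
    also have "\<dots> \<le> dist x a"
      using False assms(2) norm_triangle_ineq2[of a x] by (simp add: dist_norm norm_minus_commute)
    finally show ?thesis .
  qed
  then show "infdist x (A \<inter> cball 0 (2 * r)) \<le> infdist x A"
    using assms(1) unfolding infdist_notempty[of A, OF ex_in_conv[THEN iffD1, OF exI, OF assms(1)]]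
    by (intro cINF_greatest) auto
  show "infdist x A \<le> infdist x (A \<inter> cball 0 (2 * r))"
    using 0 by (intro infdist_mono) auto
qed

text \<open>Indices up to m see no difference between the two sets, and larger ones are capped by 1
  / j.\<close>

lemma AW_dist_Int_cball_le:
  fixes A :: "'a::euclidean_space set"
  assumes "0 \<in> A" "1 \<le> m"
  shows "AW_dist A (A \<inter> cball 0 (2 * real m)) \<le> 1 / real m"
  unfolding AW_dist_def
proof (rule cSUP_least)
  fix j :: nat assume "j \<in> {1..}"
  then have j: "1 \<le> j" by simp
  let ?s = "SUP x\<in>ball 0 (real j). \<bar>infdist x A - infdist x (A \<inter> cball 0 (2 * real m))\<bar>"
  show "min (1 / real j) ?s \<le> 1 / real m"
  proof (cases "j \<le> m")
    case True
    have "?s \<le> 0"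
    proof (rule cSUP_least)
      fix x :: 'a assume "x \<in> ball 0 (real j)"
      then have "norm x \<le> real m" using True by simp
      then show "\<bar>infdist x A - infdist x (A \<inter> cball 0 (2 * real m))\<bar> \<le> 0"
        using infdist_Int_cball[OF assms(1)] by simp
    qed (use j in simp)
    also have "0 \<le> 1 / real m" by simp
    finally show ?thesis by (rule min.coboundedI2)
  next
    case False
    then have "1 / real j \<le> 1 / real m" using assms by (intro divide_left_mono) auto
    then show ?thesis by (rule min.coboundedI1)
  qed
qed auto

text \<open>The dimension enters here: a unit vector orthogonal to \<open>e\<close> is needed to
  tilt \<open>e\<close> by the angle with cosine c.\<close>

lemma ex_unit_vector_inner_eq:
  fixes e :: "'a::euclidean_space"
  assumes "2 \<le> DIM('a)" "norm e = 1" "0 \<le> c" "c \<le> 1"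
  obtains \<theta> :: 'a where "norm \<theta> = 1" "e \<bullet> \<theta> = c"
proof -
  obtain v where v: "v \<noteq> 0" "orthogonal e v"
    using orthogonal_to_vector_exists[OF assms(1)] by blast
  define u where "u = sgn v"
  have u: "norm u = 1" "e \<bullet> u = 0"
    using v by (auto simp: u_def norm_sgn sgn_div_norm orthogonal_def)
  define \<theta> where "\<theta> = c *\<^sub>R e + sqrt (1 - c\<^sup>2) *\<^sub>R u"
  have "c\<^sup>2 \<le> 1" using assms by (simp add: power_le_one)
  then have "\<theta> \<bullet> \<theta> = 1"
    using assms u by (simp add: \<theta>_def inner_add inner_commute norm_eq_1 power2_eq_square)
  moreover have "e \<bullet> \<theta> = c" using assms u by (simp add: \<theta>_def inner_add norm_eq_1)
  ultimately show ?thesis using that by (simp add: norm_eq_1)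
qed

theorem flower_not_continuous:
  assumes "2 \<le> DIM('a::euclidean_space)"
  shows "\<not> continuous_map (Metric_space.mtopology (K0 :: 'a set set) AW_dist)
    (Metric_space.mtopology (flowers :: 'a set set) radial_AW_dist) flower"
proof
  assume cont: "continuous_map (Metric_space.mtopology (K0 :: 'a set set) AW_dist)
    (Metric_space.mtopology (flowers :: 'a set set) radial_AW_dist) flower"
  obtain e :: 'a where e: "norm e = 1" using ex_unit_vector by blast
  then have "e \<noteq> 0" by auto
  define R where "R = (\<lambda>t. t *\<^sub>R e) ` {0..}"
  have R0: "0 \<in> R" by (auto simp: R_def image_iff)
  have R: "R \<in> K0"
  proof -
    have "closed R"
      unfolding R_def using \<open>e \<noteq> 0\<close>
      by (intro closed_injective_linear_image) (auto simp: linear_scaleR_left inj_def)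
    moreover have "convex R"
      unfolding R_def by (intro convex_linear_image) (auto simp: linear_scaleR_left)
    ultimately show ?thesis using R0 by (simp add: K0_def)
  qed
  \<comment> \<open>The tolerance 1 / 2 is contradicted at level 1, where the two truncations will
    be 1 and at most 1 / 2.\<close>
  obtain \<delta> where \<delta>: "0 < \<delta>"
    "\<And>K. K \<in> K0 \<Longrightarrow> AW_dist R K < \<delta> \<Longrightarrow> radial_AW_dist (flower R) (flower K) < 1 / 2"
    using cont R
    unfolding Metric_space.metric_continuous_map[OF Metric_space_K0_AW Metric_space_flowers_radial_AW]
    by (metis half_gt_zero zero_less_one)
  obtain n where n: "inverse (real (Suc n)) < \<delta>" using reals_Archimedean[OF \<delta>(1)] by blast
  define m where "m = Suc n"
  define K where "K = R \<inter> cball 0 (2 * real m)"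
  have "K \<in> K0" using R by (auto simp: K_def K0_def convex_Int)
  moreover have "AW_dist R K < \<delta>"
    using AW_dist_Int_cball_le[OF R0, of m] n by (simp add: K_def m_def inverse_eq_divide)
  ultimately have lt: "radial_AW_dist (flower R) (flower K) < 1 / 2" by (rule \<delta>(2))
  \<comment> \<open>The direction is tilted so close to the orthogonal hyperplane that the end 2 * m
    * e of the segment \<open>K\<close> has inner product only 1 / 2 with it, while c > 0 keeps the
    ray unbounded there.\<close>
  define c where "c = 1 / (4 * real m)"
  have c: "0 < c" "c \<le> 1" "2 * real m * c = 1 / 2" by (auto simp: c_def m_def)
  obtain \<theta> where \<theta>: "norm \<theta> = 1" "e \<bullet> \<theta> = c"
    using ex_unit_vector_inner_eq[OF assms e, of c] c by auto
  \<comment> \<open>Because of the truncation at 1, the point of the ray with inner product exactly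
    1 suffices.\<close>
  have "1 \<le> radial_function (flower R) \<theta>"
    unfolding radial_function_flower[OF \<theta>(1)]
    by (rule SUP_upper2[of "(1 / c) *\<^sub>R e"]) (use c \<theta> in \<open>auto simp: R_def\<close>)
  then have 1: "truncate 1 (radial_function (flower R) \<theta>) = 1"
    by (simp add: truncate_def min_absorb1)
  have "radial_function (flower K) \<theta> \<le> ennreal (1 / 2)"
    unfolding radial_function_flower[OF \<theta>(1)]
  proof (rule SUP_least)
    fix x assume "x \<in> K"
    then obtain t where t: "0 \<le> t" "x = t *\<^sub>R e" "norm x \<le> 2 * real m"
      by (auto simp: K_def R_def)
    then have "x \<bullet> \<theta> \<le> 2 * real m * c" using e c \<theta> by (simp add: mult_right_mono)
    then show "ennreal (x \<bullet> \<theta>) \<le> ennreal (1 / 2)" unfolding c(3) by (rule ennreal_leI)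
  qed
  then have "min (ennreal 1) (radial_function (flower K) \<theta>) \<le> ennreal (1 / 2)"
    by (rule min.coboundedI2)
  then have "truncate 1 (radial_function (flower K) \<theta>) \<le> enn2real (ennreal (1 / 2))"
    unfolding truncate_def by (rule enn2real_mono) (rule ennreal_less_top)
  then have 2: "truncate 1 (radial_function (flower K) \<theta>) \<le> 1 / 2"
    by (subst (asm) enn2real_ennreal) simp_all
  show False using radial_AW_dist_ge[OF \<theta>(1), of 1 "flower R" "flower K"] 1 2 lt by simp
qed

theorem proposition5p9:
  assumes "2 \<le> DIM('a::euclidean_space)"
  shows "(Metric_space.mtopology (K0 :: 'a set set) radial_AW_dist
            homeomorphic_space Metric_space.mtopology (flowers :: 'a set set) radial_AW_dist)
       \<and> \<not> continuous_map (Metric_space.mtopology (K0 :: 'a set set) AW_dist)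
            (Metric_space.mtopology (flowers :: 'a set set) radial_AW_dist) flower"
  using K0_homeomorphic_flowers flower_not_continuous[OF assms] by blast

end
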